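(* Let $(X,d)$ be a complete metric space, $(Y,\varrho)$ be a complete linear metric space with a shift-invariant metric, and let a point $(\bar x,\bar y,\bar z)\in X\times Y\times Y$ be given. Consider set-valued mappings $F,G:X\rightrightarrows Y$, with $(\bar y,\bar z)\in F(\bar x)\times G(\bar x)$, for which there are positive constants $c'$, $r$, and $\ell<c'$ such that both the sets $\mathrm{gph}\,F\cap\big(\mathbb{B}[\bar x,2r]\times\mathbb{B}[\bar y,2c'r]\big)$ and $\mathrm{gph}\,G\cap\big(\mathbb{B}[\bar x,2r]\times\mathbb{B}[\bar z,2\ell r]\big)$ are closed; that $$\mathbb{B}(v,c'\tau)\subset F(\mathbb{B}(x,\tau))\quad\text{whenever}\quad x\in\mathbb{B}(\bar x,r),\ v\in F(x)\cap\mathbb{B}(\bar y,c'r),\ \text{and}\ \tau\in(0,r);$$ and that $$G(x)\cap\mathbb{B}(\bar z,\ell r)\subset G(x')+\{w\in Y:\varrho(w,0)\le\ell\,d(x,x')\}\quad\text{for each } x,x'\in\mathbb{B}(\bar x,2r).$$ Then $$(F+G)\big(\mathbb{B}(\bar x,t)\big)\supset\mathbb{B}(\bar y+\bar z,(c-\ell)t)\quad\text{whenever}\quad c\in(\ell,c')\ \text{and}\ t\in(0,r).$$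
   Context: $\mathbb{B}(u,r)$ and $\mathbb{B}[u,r]$ denote the open and closed balls with centre $u$ and radius $r>0$. $F:X\rightrightarrows Y$ is a set-valued mapping (values may be empty), $\mathrm{gph}\,F=\{(x,y):y\in F(x)\}$, $F(C)=\bigcup_{x\in C}F(x)$; $(F+G)(x)=F(x)+G(x)=\{y+z:y\in F(x),z\in G(x)\}$. A linear metric space with a shift-invariant metric is a vector space $Y$ with a metric $\varrho$ for which the vector operations are continuous and $\varrho(y+w,y'+w)=\varrho(y,y')$ for all $y,y',w\in Y$. *)

theory Defs
  imports "HOL-Analysis.Analysis" "HOL-Library.Set_Algebras"
begin

text \<open>
  Linear metric spaces with a shift-invariant metric, over the reals. The topology is that of
  the metric (class \<^class>\<open>metric_space\<close>). Continuity of addition (and of negation, which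
  the other axioms imply) comes from \<^class>\<open>topological_ab_group_add\<close>; as there, joint continuity
  of the scalar multiplication is expressed with product filters, since
  \<^term>\<open>nhds a \<times>\<^sub>F nhds y\<close> is the neighbourhood filter of \<open>(a, y)\<close>. Completeness is not
  part of the class.
\<close>

class shift_invariant_linear_metric_space =
  real_vector + metric_space + topological_ab_group_add +
  assumes tendsto_scaleR_Pair:
      "filterlim (\<lambda>p. fst p *\<^sub>R snd p) (nhds (a *\<^sub>R y)) (nhds a \<times>\<^sub>F nhds y)"
    and dist_shift: "dist (y + w) (y' + w) = dist y y'"

instance real_normed_vector \<subseteq> shift_invariant_linear_metric_space
proof
  fix a :: real and y w y' :: 'a
  show "filterlim (\<lambda>p. fst p *\<^sub>R snd p) (nhds (a *\<^sub>R y)) (nhds a \<times>\<^sub>F nhds y)"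
    unfolding nhds_prod[symmetric]
    by (intro tendsto_scaleR tendsto_fst tendsto_snd filterlim_ident
        tendsto_eq_rhs[OF tendsto_fst[OF filterlim_ident]] tendsto_eq_rhs[OF tendsto_snd[OF filterlim_ident]]) auto
  show "dist (y + w) (y' + w) = dist y y'"
    by (simp add: dist_norm)
qed

text \<open>
  A set-valued mapping from \<open>'a\<close> to \<open>'b\<close> is a function \<open>'a \<Rightarrow> 'b set\<close>. Set addition is the
  Minkowski sum of \<open>HOL-Library.Set_Algebras\<close>.
\<close>

definition gph :: "('a \<Rightarrow> 'b set) \<Rightarrow> ('a \<times> 'b) set" where
  "gph F = {(x, y). y \<in> F x}"

definition set_image :: "('a \<Rightarrow> 'b set) \<Rightarrow> 'a set \<Rightarrow> 'b set" where
  "set_image F C = (\<Union>x\<in>C. F x)"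

definition set_valued_sum :: "('a \<Rightarrow> 'b::plus set) \<Rightarrow> ('a \<Rightarrow> 'b set) \<Rightarrow> 'a \<Rightarrow> 'b set" where
  "set_valued_sum F G = (\<lambda>x. F x + G x)"

end

theory Submission
  imports Defs
begin

text \<open>
  This is the Lyusternik--Graves iteration, run on triples \<open>(x, v, z)\<close> with \<open>v \<in> F x\<close> and
  \<open>z \<in> G x\<close>. Given a target \<open>y\<close>, the residual is \<open>e = dist (v + z) y\<close>, which by shift invariance
  equals \<open>dist v (y - z)\<close>. Openness of \<open>F\<close> solves \<open>y - z \<in> F x'\<close> with \<open>dist x x' \<le> e / c\<close>, where
  the slack \<open>c < c'\<close> is what puts \<open>y - z\<close> into the open ball of radius \<open>c' * (e / c)\<close>; the Lipschitz
  property of \<open>G\<close> then provides \<open>z' \<in> G x'\<close> with \<open>dist z z' \<le> l * dist x x'\<close>. The new residual is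
  just \<open>dist z z'\<close>, so it is at most \<open>(l / c) * e\<close>.

  Instead of summing geometric series, the estimates use \<open>e / (c - l)\<close> as a potential: since
  \<open>e' \<le> (l / c) * e\<close>, one has \<open>e / c \<le> (e - e') / (c - l)\<close>, so every move of \<open>x\<close> is paid for by a
  decrease of the potential, and the moves of \<open>v\<close> and \<open>z\<close> by \<open>c\<close> and \<open>l\<close> times that
  decrease. The initial potential is less than \<open>t\<close> precisely when \<open>y\<close> lies in the ball of radius
  \<open>(c - l) * t\<close>; hence the iterates never leave the balls on which the hypotheses apply, and all three
  sequences converge. As consecutive iterates satisfy \<open>v' + z = y\<close>, the limits add up to \<open>y\<close>, and
  closedness of the truncated graphs places them in \<open>F x\<close> and \<open>G x\<close>.
\<close>

lemma dist_le_potential_drop: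
  fixes f :: "nat \<Rightarrow> 'a::metric_space" and \<phi> :: "nat \<Rightarrow> real"
  assumes step: "\<And>n. dist (f n) (f (Suc n)) \<le> \<phi> n - \<phi> (Suc n)" and "m \<le> n"
  shows "dist (f m) (f n) \<le> \<phi> m - \<phi> n"
  using \<open>m \<le> n\<close>
proof (induction n rule: dec_induct)
  case base
  show ?case by simp
next
  case (step n)
  then show ?case
    using assms(1)[of n] dist_triangle[of "f m" "f (Suc n)" "f n"] by linarith
qed

text \<open>
  A potential that pays for every step decreases and is bounded below, so it is a Cauchy sequence;
  the orbit inherits this.
\<close>

lemma convergent_if_potential_drop:
  fixes f :: "nat \<Rightarrow> 'a::complete_space" and \<phi> :: "nat \<Rightarrow> real"
  assumes step: "\<And>n. dist (f n) (f (Suc n)) \<le> \<phi> n - \<phi> (Suc n)"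
    and nonneg: "\<And>n. 0 \<le> \<phi> n"
  shows "convergent f"
proof -
  have "decseq \<phi>"
    unfolding decseq_Suc_iff using step zero_le_dist by (metis diff_ge_0_iff_ge order_trans)
  then obtain L where "\<phi> \<longlonglongrightarrow> L"
    using decseq_convergent[of \<phi> 0] nonneg by blast
  then have "Cauchy \<phi>"
    by (rule LIMSEQ_imp_Cauchy)
  have "Cauchy f"
  proof (rule metric_CauchyI)
    fix \<epsilon> :: real
    assume "0 < \<epsilon>"
    then obtain N where N: "\<And>m n. m \<ge> N \<Longrightarrow> n \<ge> N \<Longrightarrow> dist (\<phi> m) (\<phi> n) < \<epsilon>"
      using \<open>Cauchy \<phi>\<close> unfolding Cauchy_def by blast
    have ordered: "dist (f m) (f n) < \<epsilon>" if "N \<le> m" "m \<le> n" for m n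
      using dist_le_potential_drop[of f \<phi> m n, OF step \<open>m \<le> n\<close>] N[of m n] that by (simp add: dist_real_def)
    have "dist (f m) (f n) < \<epsilon>" if "N \<le> m" "N \<le> n" for m n
      using ordered[of m n] ordered[of n m] that by (cases "m \<le> n") (auto simp: dist_commute)
    then show "\<exists>M. \<forall>m\<ge>M. \<forall>n\<ge>M. dist (f m) (f n) < \<epsilon>"
      by blast
  qed
  then show ?thesis
    by (simp add: Cauchy_convergent_iff)
qed

text \<open>
  One step of the iteration. The hypotheses are those instances of openness and of the Lipschitz
  property that start at the current point \<open>x\<close>, so the lemma is independent of the reference point.
\<close>

lemma residual_reducing_step:
  fixes F G :: "'a::metric_space \<Rightarrow> 'b::shift_invariant_linear_metric_space set"
  assumes l: "0 < l" and lc: "l < c" and cc': "c < c'"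
    and v: "v \<in> F x" and z: "z \<in> G x"
    and small: "dist (v + z) y < c * r"
    and open_F: "\<And>\<tau>. 0 < \<tau> \<Longrightarrow> \<tau> < r \<Longrightarrow> ball v (c' * \<tau>) \<subseteq> set_image F (ball x \<tau>)"
    and lipschitz_G: "\<And>x'. dist x x' < r \<Longrightarrow> z \<in> G x' + {w. dist w 0 \<le> l * dist x x'}"
  obtains x' v' z' where "v' \<in> F x'" "z' \<in> G x'" "v' + z = y"
    "dist x x' \<le> (dist (v + z) y - dist (v' + z') y) / (c - l)"
    "dist v v' \<le> c * ((dist (v + z) y - dist (v' + z') y) / (c - l))"
    "dist z z' \<le> l * ((dist (v + z) y - dist (v' + z') y) / (c - l))"
proof -
  define e where "e = dist (v + z) y"
  have move: "dist v (y - z) = e"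
    using dist_shift[of v z "y - z"] by (simp add: e_def)
  have "\<exists>x'. y - z \<in> F x' \<and> dist x x' \<le> e / c \<and> dist x x' < r"
  proof (cases "e = 0")
    case True
    \<comment> \<open>Openness needs a positive radius; but with residual zero the current point already works,
      and \<open>r > 0\<close> follows from the bound on the residual.\<close>
    then have "0 < r"
      using small l lc by (simp add: e_def zero_less_mult_iff)
    then show ?thesis
      using True move v by (auto intro!: exI[of _ x])
  next
    case False
    then have "0 < e"
      by (simp add: e_def)
    then have "0 < e / c" "e / c < r" "e < c' * (e / c)"
      using small l lc cc' by (simp_all add: e_def field_simps)
    then have "y - z \<in> set_image F (ball x (e / c))"
      using open_F[of "e / c"] move by auto
    then show ?thesis
      using \<open>e / c < r\<close> by (force simp: set_image_def)
  qed
  then obtain x' where x': "y - z \<in> F x'" "dist x x' \<le> e / c" "dist x x' < r"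
    by blast
  obtain z' w where z': "z' \<in> G x'" and w: "z = z' + w" "dist w 0 \<le> l * dist x x'"
    using lipschitz_G[OF x'(3)] by (auto elim: set_plus_elim)
  have zz': "dist z z' \<le> l * dist x x'"
    using w dist_shift[of w z' 0] by (simp add: add.commute)
  have e': "dist (y - z + z') y = dist z z'"
    using dist_shift[of z' "y - z" z] by (simp add: algebra_simps dist_commute)
  have "l * dist x x' \<le> l * (e / c)"
    using x'(2) l by (intro mult_left_mono) auto
  then have contraction: "dist z z' \<le> l * (e / c)"
    using zz' by linarith
  \<comment> \<open>The decrease of the potential pays for a move of length \<open>e / c\<close>.\<close>
  have "(c - l) * (e / c) = e - l * (e / c)"
    using l lc by (simp add: field_simps)
  with contraction have "(c - l) * (e / c) \<le> e - dist z z'"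
    by (simp only: diff_left_mono)
  then have drop: "e / c \<le> (e - dist z z') / (c - l)"
    using lc by (simp add: pos_le_divide_eq mult.commute)
  have "c * (e / c) \<le> c * ((e - dist z z') / (c - l))"
    using drop l lc by (intro mult_left_mono) auto
  then have "e \<le> c * ((e - dist z z') / (c - l))"
    using l lc by simp
  moreover have "l * (e / c) \<le> l * ((e - dist z z') / (c - l))"
    using drop l by (intro mult_left_mono) auto
  ultimately show thesis
    using that[of "y - z" x' z'] x' z' drop contraction move e' by (auto simp: e_def)
qed

theorem theorem4p4:
  fixes F G :: "'a::complete_space \<Rightarrow> 'b::{complete_space, shift_invariant_linear_metric_space} set"
    and xbar :: 'a and ybar zbar :: 'b
    and c' r l :: real
  assumes ref_point: "(ybar, zbar) \<in> F xbar \<times> G xbar"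
    and "0 < c'" and "0 < r" and "0 < l" and "l < c'"
    and closed_F: "closed (gph F \<inter> (cball xbar (2 * r) \<times> cball ybar (2 * c' * r)))"
    and closed_G: "closed (gph G \<inter> (cball xbar (2 * r) \<times> cball zbar (2 * l * r)))"
    and open_F: "\<And>x v \<tau>. \<lbrakk>x \<in> ball xbar r; v \<in> F x \<inter> ball ybar (c' * r); \<tau> \<in> {0<..<r}\<rbrakk>
      \<Longrightarrow> ball v (c' * \<tau>) \<subseteq> set_image F (ball x \<tau>)"
    and lipschitz_G: "\<And>x x'. \<lbrakk>x \<in> ball xbar (2 * r); x' \<in> ball xbar (2 * r)\<rbrakk>
      \<Longrightarrow> G x \<inter> ball zbar (l * r) \<subseteq> G x' + {w. dist w 0 \<le> l * dist x x'}"
  shows "\<forall>c\<in>{l<..<c'}. \<forall>t\<in>{0<..<r}.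
    ball (ybar + zbar) ((c - l) * t) \<subseteq> set_image (set_valued_sum F G) (ball xbar t)"
proof (intro ballI subsetI)
  fix c t y
  assume "c \<in> {l<..<c'}" and "t \<in> {0<..<r}" and y: "y \<in> ball (ybar + zbar) ((c - l) * t)"
  then have c: "l < c" "c < c'" "0 < c" and t: "0 < t" "t < r"
    using \<open>0 < l\<close> by auto
  define e where "e = (\<lambda>(x :: 'a, v, z). dist (v + z) y)"
  define \<phi> where "\<phi> s = e s / (c - l)" for s
  define \<rho> where "\<rho> = \<phi> (xbar, ybar, zbar)"
  have \<phi>_nonneg: "0 \<le> \<phi> s" for s
    using c by (auto simp: \<phi>_def e_def split: prod.split)
  have \<rho>: "0 \<le> \<rho>" "\<rho> < t"
    using y c \<phi>_nonneg[of "(xbar, ybar, zbar)"]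
    by (auto simp: \<rho>_def \<phi>_def e_def pos_divide_less_eq mult.commute)
  \<comment> \<open>What keeps the iterates near the reference point: the distance travelled is at most the
    part of the initial potential used up so far.\<close>
  define inv where "inv = (\<lambda>(x, v, z). v \<in> F x \<and> z \<in> G x
    \<and> dist xbar x \<le> \<rho> - \<phi> (x, v, z) \<and> dist ybar v \<le> c * (\<rho> - \<phi> (x, v, z))
    \<and> dist zbar z \<le> l * (\<rho> - \<phi> (x, v, z)))"
  define nxt where "nxt = (\<lambda>(x, v, z) (x', v', z'). v' + z = y
    \<and> dist x x' \<le> \<phi> (x, v, z) - \<phi> (x', v', z')
    \<and> dist v v' \<le> c * (\<phi> (x, v, z) - \<phi> (x', v', z'))
    \<and> dist z z' \<le> l * (\<phi> (x, v, z) - \<phi> (x', v', z')))"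

  have bounds: "dist xbar x \<le> \<rho>" "dist ybar v \<le> c * \<rho>" "dist zbar z \<le> l * \<rho>" "\<phi> (x, v, z) \<le> \<rho>"
    if "inv (x, v, z)" for x v z
  proof -
    have "c * (\<rho> - \<phi> (x, v, z)) \<le> c * \<rho>" "l * (\<rho> - \<phi> (x, v, z)) \<le> l * \<rho>"
      using \<phi>_nonneg c \<open>0 < l\<close> by (auto intro!: mult_left_mono)
    then show "dist xbar x \<le> \<rho>" "dist ybar v \<le> c * \<rho>" "dist zbar z \<le> l * \<rho>" "\<phi> (x, v, z) \<le> \<rho>"
      using that \<phi>_nonneg[of "(x, v, z)"] zero_le_dist[of xbar x]
      by (auto simp: inv_def simp del: zero_le_dist)
  qed
  have "c * \<rho> < c' * r" "l * \<rho> < l * r"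
    using c \<rho> t \<open>0 < l\<close> by (auto intro!: mult_strict_mono)

  have start: "inv (xbar, ybar, zbar)"
    using ref_point by (simp add: inv_def \<rho>_def)
  have continue: "\<exists>s'. inv s' \<and> nxt s s'" if "inv s" for s
  proof -
    obtain x v z where s: "s = (x, v, z)"
      by (cases s)
    note b = bounds[OF that[unfolded s]]
    have v: "v \<in> F x" and z: "z \<in> G x"
      using that by (auto simp: s inv_def)
    have x: "dist xbar x < r"
      using b \<rho> t by linarith
    have v_near: "dist ybar v < c' * r" and z_near: "dist zbar z < l * r"
      using b \<open>c * \<rho> < c' * r\<close> \<open>l * \<rho> < l * r\<close> by linarith+
    have "\<phi> (x, v, z) < r"
      using b \<rho> t by linarith
    then have "dist (v + z) y < (c - l) * r"
      using c by (simp add: \<phi>_def e_def pos_divide_less_eq mult.commute)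
    also have "\<dots> \<le> c * r"
      using \<open>0 < l\<close> \<open>0 < r\<close> by (intro mult_right_mono) auto
    finally have small: "dist (v + z) y < c * r" .
    have opn: "ball v (c' * \<tau>) \<subseteq> set_image F (ball x \<tau>)" if "0 < \<tau>" "\<tau> < r" for \<tau>
      using open_F[of x v \<tau>] x v v_near that by auto
    have lip: "z \<in> G x' + {w. dist w 0 \<le> l * dist x x'}" if "dist x x' < r" for x'
      using lipschitz_G[of x x'] x z z_near that dist_triangle[of xbar x' x] \<open>0 < r\<close> by auto
    obtain x' v' z' where n: "v' \<in> F x'" "z' \<in> G x'" "v' + z = y"
      "dist x x' \<le> (dist (v + z) y - dist (v' + z') y) / (c - l)"
      "dist v v' \<le> c * ((dist (v + z) y - dist (v' + z') y) / (c - l))"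
      "dist z z' \<le> l * ((dist (v + z) y - dist (v' + z') y) / (c - l))"
      by (rule residual_reducing_step[of l c c' v F x z G y r])
        (use \<open>0 < l\<close> c v z small opn lip in auto)
    have nxt: "nxt (x, v, z) (x', v', z')"
      using n by (simp add: nxt_def \<phi>_def e_def diff_divide_distrib)
    then have "inv (x', v', z')"
      using that n(1,2) dist_triangle[of xbar x' x] dist_triangle[of ybar v' v]
        dist_triangle[of zbar z' z]
      by (auto simp: s inv_def nxt_def right_diff_distrib)
    with nxt show ?thesis
      by (auto simp: s)
  qed

  obtain S where S0: "S 0 = (xbar, ybar, zbar)" and inv: "\<And>n. inv (S n)"
    and nxt: "\<And>n. nxt (S n) (S (Suc n))"
    using dependent_nat_choice[of "\<lambda>n s. inv s \<and> (n = 0 \<longrightarrow> s = (xbar, ybar, zbar))" "\<lambda>_. nxt"]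
      start continue by (metis nat.distinct(1))
  define X where "X n = fst (S n)" for n
  define V where "V n = fst (snd (S n))" for n
  define Z where "Z n = snd (snd (S n))" for n
  have S: "S n = (X n, V n, Z n)" for n
    by (simp add: X_def V_def Z_def)
  have FX: "V n \<in> F (X n)" and GX: "Z n \<in> G (X n)" and VZ: "V (Suc n) + Z n = y" for n
    using inv[of n] nxt[of n] by (auto simp: S inv_def nxt_def)
  have "convergent X"
    by (rule convergent_if_potential_drop[of _ "\<lambda>n. \<phi> (S n)"])
      (use nxt \<phi>_nonneg in \<open>auto simp: S nxt_def\<close>)
  moreover have "convergent V"
    by (rule convergent_if_potential_drop[of _ "\<lambda>n. c * \<phi> (S n)"])
      (use nxt \<phi>_nonneg c in \<open>auto simp: S nxt_def right_diff_distrib\<close>)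
  moreover have "convergent Z"
    by (rule convergent_if_potential_drop[of _ "\<lambda>n. l * \<phi> (S n)"])
      (use nxt \<phi>_nonneg \<open>0 < l\<close> in \<open>auto simp: S nxt_def right_diff_distrib\<close>)
  ultimately obtain x v z where lims: "X \<longlonglongrightarrow> x" "V \<longlonglongrightarrow> v" "Z \<longlonglongrightarrow> z"
    by (auto simp: convergent_def)

  have near: "dist xbar (X n) \<le> \<rho>" "dist ybar (V n) \<le> 2 * c' * r" "dist zbar (Z n) \<le> 2 * l * r" for n
    using bounds[of "X n" "V n" "Z n"] inv[of n] \<open>c * \<rho> < c' * r\<close> \<open>l * \<rho> < l * r\<close>
      mult_pos_pos[OF \<open>0 < c'\<close> \<open>0 < r\<close>] mult_pos_pos[OF \<open>0 < l\<close> \<open>0 < r\<close>]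
    by (auto simp: S)
  have X_near: "dist xbar (X n) \<le> 2 * r" for n
    using near(1)[of n] \<rho> t by linarith
  have "(x, v) \<in> gph F \<inter> (cball xbar (2 * r) \<times> cball ybar (2 * c' * r))"
    by (rule closed_sequentially[OF closed_F, of "\<lambda>n. (X n, V n)"])
      (use near X_near FX in \<open>auto simp: gph_def intro!: tendsto_Pair lims\<close>)
  moreover have "(x, z) \<in> gph G \<inter> (cball xbar (2 * r) \<times> cball zbar (2 * l * r))"
    by (rule closed_sequentially[OF closed_G, of "\<lambda>n. (X n, Z n)"])
      (use near X_near GX in \<open>auto simp: gph_def intro!: tendsto_Pair lims\<close>)
  moreover have "v + z = y"
  proof -
    have "(\<lambda>n. V (Suc n) + Z n) \<longlonglongrightarrow> v + z"
      by (intro tendsto_add LIMSEQ_Suc lims)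
    then show ?thesis
      by (simp add: VZ LIMSEQ_const_iff)
  qed
  moreover have "dist xbar x \<le> \<rho>"
    by (rule LIMSEQ_le_const2[OF tendsto_dist[OF tendsto_const lims(1)]]) (use near in auto)
  ultimately show "y \<in> set_image (set_valued_sum F G) (ball xbar t)"
    using \<rho> by (auto simp: set_image_def set_valued_sum_def gph_def intro!: bexI[of _ x] set_plus_intro)
qed

end
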